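(* Let $\mathcal{H}$ be a committee space. Let $v=(v_\gamma)_\gamma$ be a random multiplier model for $\mathcal{H}$, and let $f_v=\sum_\gamma v_\gamma z^\gamma$, $R_v=E(M_{f_v}M_{f_v}^* )$ and $C_v=E(M_{f_v}^*M_{f_v})$. Then $$\|R_v\|\le\|C_v\|.$$
   Context: A committee space is a Hilbert space $\mathcal{H}$ of formal power series (in commuting or noncommuting variables, in one, several or infinitely many variables) in which polynomials are dense, such that (1) $\langle z^\alpha,z^\beta\rangle=0$ whenever $\alpha\ne\beta$; (2) (committee inequality) $\|z^\alpha\|\,\|z^\beta\|\ge\|z^{\alpha+\beta}\|$ for all multi-indices $\alpha,\beta$. Here multi-indices index the monomials $z^\alpha$ and $z^{\alpha+\beta}=z^\alpha z^\beta$; in the noncommutative case multi-indices are words and $\alpha+\beta$ denotes concatenation. A multiplier of $\mathcal{H}$ is a power series $f$ such that $M_f:h\mapsto fh$ is a bounded operator on $\mathcal{H}$. A random multiplier model is a family of scalar random variables $v_\gamma$ indexed by multi-indices $\gamma$ such that (1) $E(v_\gamma)=0$; (2) $E(|v_\gamma|^2)=w_\gamma<\infty$; (3) $E(\overline{v_\gamma}v_{\gamma'})=0$ if $\gamma\ne\gamma'$; (4) there is a constant $C>0$ such that the function $f_v=\sum_\gamma v_\gamma z^\gamma$ satisfies $\|M_{f_v}\|\le C$ almost surely. Expectations of operators are taken in the weak sense: $\langle E(T)g,h\rangle=E\langle Tg,h\rangle$ for all $g,h\in\mathcal{H}$. Norms of operators are operator norms.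
   Formalization: The normalization ‖1‖ = 1 is assumed; without it the inequality can fail. Coefficient functionals are taken to be continuous, as usual. R_v and C_v are shown to exist for countably many variables; otherwise the inequality holds whenever they exist. *)

theory Defs
  imports "HOL-Probability.Probability" "HOL-Library.Poly_Mapping"
begin

section \<open>Complex Hilbert spaces\<close>

text \<open>The inner product is linear in its first argument. Its real part is the inner product of the
  underlying real Hilbert space, so the norm, boundedness (\<^term>\<open>bounded_linear\<close>) and the
  operator norm (\<^term>\<open>onorm\<close>) are those of the library.\<close>

class complex_hilbert_space = real_inner + complete_space +
  fixes scaleC :: "complex \<Rightarrow> 'a \<Rightarrow> 'a"
    and cinner :: "'a \<Rightarrow> 'a \<Rightarrow> complex"
  assumes scaleC_add_right: "scaleC c (x + y) = scaleC c x + scaleC c y"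
    and scaleC_add_left: "scaleC (c + d) x = scaleC c x + scaleC d x"
    and scaleC_scaleC: "scaleC c (scaleC d x) = scaleC (c * d) x"
    and scaleC_of_real: "scaleC (complex_of_real r) x = scaleR r x"
    and cinner_add_left: "cinner (x + y) z = cinner x z + cinner y z"
    and cinner_scaleC_left: "cinner (scaleC c x) y = c * cinner x y"
    and cinner_commute: "cinner x y = cnj (cinner y x)"
    and inner_eq_Re_cinner: "inner x y = Re (cinner x y)"

definition cadjoint :: "('h::complex_hilbert_space \<Rightarrow> 'h) \<Rightarrow> 'h \<Rightarrow> 'h" where
  "cadjoint T = (SOME S. \<forall>x y. cinner (T x) y = cinner x (S y))"


section \<open>Formal power series\<close>

text \<open>A formal power series is its family of coefficients, indexed by a type \<open>'m\<close> of multi-indices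
  with addition \<open>add\<close>. For commuting variables indexed by \<open>'i\<close> these are the finitely supported
  exponents \<open>'i \<Rightarrow>\<^sub>0 nat\<close> with addition; for noncommuting variables they are the words \<open>'i list\<close>
  with concatenation. In both cases the set of factorisations below is finite.\<close>

definition series_mult ::
    "('m \<Rightarrow> 'm \<Rightarrow> 'm) \<Rightarrow> ('m \<Rightarrow> complex) \<Rightarrow> ('m \<Rightarrow> complex) \<Rightarrow> 'm \<Rightarrow> complex" where
  "series_mult add f g \<gamma> = (\<Sum>(\<alpha>, \<beta>)\<in>{(\<alpha>, \<beta>). add \<alpha> \<beta> = \<gamma>}. f \<alpha> * g \<beta>)"

text \<open>A Hilbert space of formal power series is a Hilbert space \<open>'h\<close> with an injective linear map
  \<open>coef\<close> to coefficient families. As usual for such spaces, the coefficient functionals are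
  continuous; without this a series need not be the norm limit of its own monomials.\<close>

locale power_series_hilbert_space =
  fixes coef :: "'h::complex_hilbert_space \<Rightarrow> 'm \<Rightarrow> complex"
  assumes inj_coeff: "inj coef"
    and coeff_add: "coef (x + y) \<alpha> = coef x \<alpha> + coef y \<alpha>"
    and coeff_scaleC: "coef (scaleC c x) \<alpha> = c * coef x \<alpha>"
    and continuous_coeff: "continuous_on UNIV (\<lambda>x. coef x \<alpha>)"

definition monomial_vec :: "('h \<Rightarrow> 'm \<Rightarrow> complex) \<Rightarrow> 'm \<Rightarrow> 'h" where
  "monomial_vec coef \<alpha> = inv coef (\<lambda>\<beta>. if \<beta> = \<alpha> then 1 else 0)"

text \<open>The committee inequality for the empty multi-index only gives norm at least 1 for the constant
  series 1. The normalisation to norm 1 is not part of this definition.\<close>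

locale committee_space = power_series_hilbert_space coef
  for add :: "'m \<Rightarrow> 'm \<Rightarrow> 'm"
    and coef :: "'h::complex_hilbert_space \<Rightarrow> 'm \<Rightarrow> complex" +
  assumes polynomial_in_range: "finite {\<alpha>. p \<alpha> \<noteq> 0} \<Longrightarrow> p \<in> range coef"
    and polynomials_dense: "closure {x. finite {\<alpha>. coef x \<alpha> \<noteq> 0}} = UNIV"
    and monomials_orthogonal:
      "\<alpha> \<noteq> \<beta> \<Longrightarrow> cinner (monomial_vec coef \<alpha>) (monomial_vec coef \<beta>) = 0"
    and committee_inequality:
      "norm (monomial_vec coef \<alpha>) * norm (monomial_vec coef \<beta>)
         \<ge> norm (monomial_vec coef (add \<alpha> \<beta>))"


section \<open>Multipliers\<close>

definition mult_op ::
    "('m \<Rightarrow> 'm \<Rightarrow> 'm) \<Rightarrow> ('h \<Rightarrow> 'm \<Rightarrow> complex) \<Rightarrow> ('m \<Rightarrow> complex) \<Rightarrow> 'h \<Rightarrow> 'h" where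
  "mult_op add coef f h = inv coef (series_mult add f (coef h))"

definition multiplier ::
    "('m \<Rightarrow> 'm \<Rightarrow> 'm) \<Rightarrow> ('h::complex_hilbert_space \<Rightarrow> 'm \<Rightarrow> complex) \<Rightarrow> ('m \<Rightarrow> complex) \<Rightarrow> bool" where
  "multiplier add coef f \<longleftrightarrow>
     (\<forall>h. series_mult add f (coef h) \<in> range coef) \<and> bounded_linear (mult_op add coef f)"


section \<open>Random multipliers\<close>

locale random_multiplier_model = committee_space add coef + prob_space P
  for add :: "'m \<Rightarrow> 'm \<Rightarrow> 'm"
    and coef :: "'h::complex_hilbert_space \<Rightarrow> 'm \<Rightarrow> complex"
    and P :: "'w measure"
    and v :: "'m \<Rightarrow> 'w \<Rightarrow> complex" +
  assumes random_variable_v: "v \<gamma> \<in> borel_measurable P"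
    and mean_zero: "(LINT \<omega>|P. v \<gamma> \<omega>) = 0"
    and square_integrable: "integrable P (\<lambda>\<omega>. (cmod (v \<gamma> \<omega>))\<^sup>2)"
    and uncorrelated: "\<gamma> \<noteq> \<gamma>' \<Longrightarrow> (LINT \<omega>|P. cnj (v \<gamma> \<omega>) * v \<gamma>' \<omega>) = 0"
    and bounded_multiplier:
      "\<exists>C>0. AE \<omega> in P. multiplier add coef (\<lambda>\<gamma>. v \<gamma> \<omega>) \<and>
                       onorm (mult_op add coef (\<lambda>\<gamma>. v \<gamma> \<omega>)) \<le> C"

text \<open>\<open>has_weak_expectation P T S\<close> means \<open>E(T) = S\<close> in the weak sense. The operators \<open>T \<omega>\<close> of
  interest are only meaningful almost surely, hence the completion of \<open>P\<close>: values on a null set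
  must not affect measurability.\<close>

definition has_weak_expectation ::
    "'w measure \<Rightarrow> ('w \<Rightarrow> 'h \<Rightarrow> 'h::complex_hilbert_space) \<Rightarrow> ('h \<Rightarrow> 'h) \<Rightarrow> bool" where
  "has_weak_expectation P T S \<longleftrightarrow> bounded_linear S \<and>
     (\<forall>g h. integrable (completion P) (\<lambda>\<omega>. cinner (T \<omega> g) h) \<and>
            cinner (S g) h = (LINT \<omega>|completion P. cinner (T \<omega> g) h))"

definition is_row_expectation ::
    "('m \<Rightarrow> 'm \<Rightarrow> 'm) \<Rightarrow> ('h::complex_hilbert_space \<Rightarrow> 'm \<Rightarrow> complex) \<Rightarrow> 'w measure \<Rightarrow>
     ('m \<Rightarrow> 'w \<Rightarrow> complex) \<Rightarrow> ('h \<Rightarrow> 'h) \<Rightarrow> bool" where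
  "is_row_expectation add coef P v R \<longleftrightarrow>
     has_weak_expectation P
       (\<lambda>\<omega>. let M = mult_op add coef (\<lambda>\<gamma>. v \<gamma> \<omega>) in M \<circ> cadjoint M) R"

definition is_column_expectation ::
    "('m \<Rightarrow> 'm \<Rightarrow> 'm) \<Rightarrow> ('h::complex_hilbert_space \<Rightarrow> 'm \<Rightarrow> complex) \<Rightarrow> 'w measure \<Rightarrow>
     ('m \<Rightarrow> 'w \<Rightarrow> complex) \<Rightarrow> ('h \<Rightarrow> 'h) \<Rightarrow> bool" where
  "is_column_expectation add coef P v C \<longleftrightarrow>
     has_weak_expectation P
       (\<lambda>\<omega>. let M = mult_op add coef (\<lambda>\<gamma>. v \<gamma> \<omega>) in cadjoint M \<circ> M) C"

end

theory Submission
  imports Defs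
begin

text \<open>\<open>R\<^sub>v\<close> is diagonal in the orthogonal basis of monomials. Since the \<open>v\<^sub>\<gamma>\<close> are uncorrelated, its
  eigenvalue at \<open>z\<^sup>\<delta>\<close> is the finite sum of \<open>w\<^sub>\<alpha> \<parallel>z\<^sup>\<delta>\<parallel>\<^sup>2 / \<parallel>z\<^sup>\<beta>\<parallel>\<^sup>2\<close> over \<open>\<alpha> + \<beta> = \<delta>\<close>. By the committee
  inequality each term is at most \<open>w\<^sub>\<alpha> \<parallel>z\<^sup>\<alpha>\<parallel>\<^sup>2\<close>, and different terms have different \<open>\<alpha>\<close>, so the
  eigenvalue is at most \<open>E \<parallel>M 1\<parallel>\<^sup>2 = \<langle>C\<^sub>v 1, 1\<rangle> \<le> \<parallel>C\<^sub>v\<parallel>\<close>. The expectations exist by the Riesz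
  representation theorem once their matrix coefficients are measurable, and this is where
  countability of the index set enters, through Parseval's identity.\<close>

section \<open>Complex Hilbert spaces\<close>

lemma scaleC_zero_left [simp]: "scaleC 0 x = 0"
  by (metis of_real_0 scaleC_of_real scaleR_zero_left)

lemma cinner_add_right: "cinner x (y + z) = cinner x y + cinner x z"
  by (metis cinner_add_left cinner_commute complex_cnj_add)

lemma cinner_scaleC_right: "cinner x (scaleC c y) = cnj c * cinner x y"
  by (metis cinner_commute cinner_scaleC_left complex_cnj_mult)

lemma cinner_zero_left [simp]: "cinner 0 x = 0"
  by (metis add_cancel_right_left cinner_add_left)

lemma cinner_zero_right [simp]: "cinner x 0 = 0"
  by (metis cinner_commute cinner_zero_left complex_cnj_zero)

lemma cinner_sum_left: "cinner (\<Sum>i\<in>A. f i) y = (\<Sum>i\<in>A. cinner (f i) y)"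
  by (induction A rule: infinite_finite_induct) (auto simp: cinner_add_left)

lemma cinner_sum_right: "cinner x (\<Sum>i\<in>A. f i) = (\<Sum>i\<in>A. cinner x (f i))"
  by (induction A rule: infinite_finite_induct) (auto simp: cinner_add_right)

lemma cinner_self: "cinner x x = complex_of_real ((norm x)\<^sup>2)"
proof -
  have "Im (cinner x x) = 0"
    using cinner_commute[of x x] by (simp add: complex_eq_iff)
  moreover have "Re (cinner x x) = (norm x)\<^sup>2"
    by (simp add: power2_norm_eq_inner inner_eq_Re_cinner)
  ultimately show ?thesis
    by (simp add: complex_eq_iff)
qed

lemma cmod_cinner_self: "cmod (cinner x x) = (norm x)\<^sup>2"
  by (simp only: cinner_self norm_of_real abs_power2)

lemma norm_scaleC [simp]: "norm (scaleC c x) = cmod c * norm x"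
proof -
  have "complex_of_real ((norm (scaleC c x))\<^sup>2) = complex_of_real ((cmod c * norm x)\<^sup>2)"
    unfolding cinner_self[symmetric] cinner_scaleC_left cinner_scaleC_right
    using complex_norm_square[of c] by (simp add: cinner_self power_mult_distrib mult_ac)
  then have "(norm (scaleC c x))\<^sup>2 = (cmod c * norm x)\<^sup>2"
    using of_real_eq_iff by blast
  then show ?thesis
    by (rule power2_eq_imp_eq) auto
qed

lemma cmod_cinner_le: "cmod (cinner x y) \<le> norm x * norm y"
proof (cases "cinner x y = 0")
  case False
  \<comment> \<open>\<open>?c\<close> is the unimodular factor that rotates
    \<open>cinner x y\<close> onto its modulus, so the real Cauchy-Schwarz inequality applies to
    \<open>scaleC ?c x\<close> and \<open>y\<close>.\<close>
  let ?z = "cinner x y" and ?c = "cnj (cinner x y) / cmod (cinner x y)"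
  have "?c * ?z = cmod ?z"
    using False by (simp add: field_simps complex_norm_square[symmetric] power2_eq_square)
  then have "cmod ?z = inner (scaleC ?c x) y"
    by (simp add: inner_eq_Re_cinner cinner_scaleC_left)
  also have "\<dots> \<le> norm (scaleC ?c x) * norm y"
    by (rule norm_cauchy_schwarz)
  also have "\<dots> = norm x * norm y"
    using False by (simp add: norm_divide)
  finally show ?thesis .
qed auto

lemma cinner_diff_left: "cinner (x - y) z = cinner x z - cinner y z"
  by (metis add_diff_cancel cinner_add_left diff_add_cancel)

lemma bounded_bilinear_cinner:
  "bounded_bilinear (cinner :: 'h::complex_hilbert_space \<Rightarrow> 'h \<Rightarrow> complex)"
proof
  show "cinner (r *\<^sub>R x) y = r *\<^sub>R cinner x y" "cinner x (r *\<^sub>R y) = r *\<^sub>R cinner x y" for r and x y :: 'h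
    unfolding scaleC_of_real[symmetric] cinner_scaleC_left cinner_scaleC_right
    by (simp_all add: scaleR_conv_of_real)
  show "\<exists>K. \<forall>x y :: 'h. norm (cinner x y) \<le> norm x * norm y * K"
    using cmod_cinner_le by (intro exI[of _ 1]) auto
qed (auto simp: cinner_add_left cinner_add_right)

lemmas continuous_on_cinner = bounded_bilinear.continuous_on[OF bounded_bilinear_cinner]

lemma cinner_ext:
  fixes x y :: "'h::complex_hilbert_space"
  assumes "\<And>z. cinner x z = cinner y z"
  shows "x = y"
proof -
  have "inner (x - y) (x - y) = 0"
    using assms[of "x - y"] by (simp add: inner_eq_Re_cinner cinner_diff_left)
  then show ?thesis
    by simp
qed

section \<open>Orthogonal sums and the Riesz representation theorem\<close>

lemma norm_sum_orthogonal:
  fixes f :: "'i \<Rightarrow> 'h::complex_hilbert_space"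
  assumes "finite A" "\<And>i j. i \<in> A \<Longrightarrow> j \<in> A \<Longrightarrow> i \<noteq> j \<Longrightarrow> cinner (f i) (f j) = 0"
  shows "(norm (\<Sum>i\<in>A. f i))\<^sup>2 = (\<Sum>i\<in>A. (norm (f i))\<^sup>2)"
proof -
  have "cinner (\<Sum>i\<in>A. f i) (\<Sum>i\<in>A. f i) = (\<Sum>i\<in>A. \<Sum>j\<in>A. cinner (f i) (f j))"
    unfolding cinner_sum_left cinner_sum_right by (rule sum.swap)
  also have "\<dots> = (\<Sum>i\<in>A. \<Sum>j\<in>A. if j = i then cinner (f i) (f i) else 0)"
    using assms by (intro sum.cong refl) auto
  also have "\<dots> = (\<Sum>i\<in>A. cinner (f i) (f i))"
    using assms by (simp add: sum.delta)
  finally have "complex_of_real ((norm (\<Sum>i\<in>A. f i))\<^sup>2)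
      = complex_of_real (\<Sum>i\<in>A. (norm (f i))\<^sup>2)"
    unfolding cinner_self by simp
  then show ?thesis
    using of_real_eq_iff by blast
qed

text \<open>The representing vector is the minimiser of \<open>\<parallel>x\<parallel>\<^sup>2 / 2 - f x\<close>: the parallelogram law makes every
  minimising sequence Cauchy.\<close>

lemma riesz_real:
  fixes f :: "'h::{real_inner,complete_space} \<Rightarrow> real"
  assumes "bounded_linear f"
  shows "\<exists>y. \<forall>x. f x = inner x y"
proof -
  interpret f: bounded_linear f by fact
  obtain K where K: "K > 0" "\<And>x. norm (f x) \<le> norm x * K"
    using f.pos_bounded by blast
  define \<Phi> where "\<Phi> x = (norm x)\<^sup>2 / 2 - f x" for x
  \<comment> \<open>Completing the square: \<open>f x \<le> norm x * K\<close> and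
    \<open>(norm x - K)\<^sup>2 \<ge> 0\<close>.\<close>
  have lower: "\<Phi> x \<ge> - K\<^sup>2 / 2" for x
  proof -
    have "f x \<le> norm x * K"
      using K(2)[of x] by simp
    moreover have "0 \<le> (norm x - K)\<^sup>2"
      by simp
    ultimately show ?thesis
      by (simp add: \<Phi>_def power2_eq_square algebra_simps)
  qed
  then have bdd: "bdd_below (range \<Phi>)"
    by (intro bdd_belowI[of _ "- K\<^sup>2 / 2"]) auto
  define m where "m = Inf (range \<Phi>)"
  have m_le: "m \<le> \<Phi> x" for x
    unfolding m_def by (rule cInf_lower) (use bdd in auto)
  have "\<exists>x. \<Phi> x < m + 1 / Suc n" for n
    using cInf_lessD[of "range \<Phi>" "m + 1 / Suc n"] unfolding m_def by auto
  then obtain X where X: "\<And>n. \<Phi> (X n) < m + 1 / Suc n"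
    by metis
  \<comment> \<open>The linear terms cancel and the parallelogram law remains. Since \<Phi> is at
    least \<open>m\<close> at the midpoint, the right side is small when both values of \<Phi> are
    near \<open>m\<close>.\<close>
  have par: "(norm (x - y))\<^sup>2 = 4 * (\<Phi> x + \<Phi> y - 2 * \<Phi> ((1/2) *\<^sub>R (x + y)))" for x y
  proof -
    have "\<Phi> ((1/2) *\<^sub>R (x + y)) = inner (x + y) (x + y) / 8 - (f x + f y) / 2"
      by (simp add: \<Phi>_def f.scaleR f.add power_mult_distrib power2_norm_eq_inner power_divide)
    then show ?thesis
      by (simp add: \<Phi>_def power2_norm_eq_inner inner_add_left inner_add_right inner_diff_left
          inner_diff_right inner_commute add_divide_distrib diff_divide_distrib)
  qed
  have "Cauchy X"
  proof (rule metric_CauchyI)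
    fix e :: real assume "e > 0"
    \<comment> \<open>For k, l \<ge> N both values of \<Phi> lie below \<open>m + 1 / N\<close>, so
      \<open>par\<close> bounds the squared distance by \<open>8 / N\<close>.\<close>
    obtain N where N: "8 / e\<^sup>2 < real N"
      using reals_Archimedean2 by blast
    have "dist (X k) (X l) < e" if "k \<ge> N" "l \<ge> N" for k l
    proof -
      have N0: "real N > 0"
        using N \<open>e > 0\<close> by (smt (verit) divide_pos_pos zero_less_power)
      have *: "1 / Suc j \<le> 1 / real N" if "j \<ge> N" for j
        using that N0 by (intro divide_left_mono) auto
      have "(norm (X k - X l))\<^sup>2 < 4 * (2 / real N)"
        using par[of "X k" "X l"] m_le[of "(1/2) *\<^sub>R (X k + X l)"] X[of k] X[of l] *[of k] *[of l] that
        by simp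
      also have "\<dots> < e\<^sup>2"
        using N N0 \<open>e > 0\<close> by (simp add: field_simps)
      finally show ?thesis
        using \<open>e > 0\<close> by (simp add: dist_norm power_less_imp_less_base)
    qed
    then show "\<exists>M. \<forall>k\<ge>M. \<forall>l\<ge>M. dist (X k) (X l) < e"
      by blast
  qed
  then obtain y where y: "X \<longlonglongrightarrow> y"
    using Cauchy_convergent convergent_def by blast
  have "(\<lambda>n. \<Phi> (X n)) \<longlonglongrightarrow> \<Phi> y"
    unfolding \<Phi>_def by (intro tendsto_intros f.tendsto y) auto
  moreover have "(\<lambda>n. m + 1 / Suc n) \<longlonglongrightarrow> m + 0"
    by (intro tendsto_intros LIMSEQ_Suc lim_const_over_n)
  ultimately have "\<Phi> y \<le> m"
    using X by (intro tendsto_le[of sequentially]) (auto intro: less_imp_le eventuallyI)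
  then have min: "\<Phi> y \<le> \<Phi> x" for x
    using m_le[of x] by linarith
  have "f x = inner x y" for x
  proof -
    \<comment> \<open>\<open>a\<close> is the derivative of \<Phi> at the minimiser \<open>y\<close>
      in direction \<open>x\<close>, so it must vanish.\<close>
    define a where "a = inner x y - f x"
    have quad: "0 \<le> t * a + t\<^sup>2 * (norm x)\<^sup>2 / 2" for t
    proof -
      have "(norm (y + t *\<^sub>R x))\<^sup>2 = (norm y)\<^sup>2 + 2 * t * inner x y + t\<^sup>2 * (norm x)\<^sup>2"
        unfolding power2_norm_eq_inner
        by (simp add: inner_add_left inner_add_right inner_commute power2_eq_square)
      then show ?thesis
        using min[of "y + t *\<^sub>R x"] by (simp add: \<Phi>_def a_def f.add f.scaleR field_simps)
    qed
    have "a = 0"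
    proof (cases "norm x = 0")
      case True
      then show ?thesis
        using f.zero by (simp add: a_def)
    next
      case False
      \<comment> \<open>The quadratic in \<open>quad\<close> is smallest at
        \<open>t = - a / (norm x)\<^sup>2\<close>, where its value is negative unless
        \<open>a = 0\<close>.\<close>
      then have "0 \<le> - (a\<^sup>2 / (norm x)\<^sup>2) / 2"
        using quad[of "- a / (norm x)\<^sup>2"] by (simp add: power2_eq_square field_simps)
      then show ?thesis
        using False by (simp add: divide_le_0_iff)
    qed
    then show ?thesis
      by (simp add: a_def)
  qed
  then show ?thesis
    by blast
qed

text \<open>The real theorem represents \<open>Re (F x)\<close>; complex linearity recovers the
  imaginary part, which is the real part of \<open>F (scaleC (- \<i>) x)\<close>.\<close>

lemma riesz_complex:
  fixes F :: "'h::complex_hilbert_space \<Rightarrow> complex"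
  assumes add: "\<And>x y. F (x + y) = F x + F y"
    and scaleC: "\<And>c x. F (scaleC c x) = c * F x"
    and bound: "\<And>x. cmod (F x) \<le> K * norm x"
  shows "\<exists>y. \<forall>x. F x = cinner x y"
proof -
  have "bounded_linear (\<lambda>x. Re (F x))"
  proof (rule bounded_linear_intro)
    show "Re (F (r *\<^sub>R x)) = r *\<^sub>R Re (F x)" for r x
      unfolding scaleC_of_real[symmetric] scaleC by simp
    show "norm (Re (F x)) \<le> norm x * K" for x
      using bound[of x] abs_Re_le_cmod[of "F x"] by (simp add: mult.commute)
  qed (simp add: add)
  then obtain y where y: "\<And>x. Re (F x) = Re (cinner x y)"
    using riesz_real inner_eq_Re_cinner by metis
  have "Im (F x) = Im (cinner x y)" for x
    using y[of "scaleC (- \<i>) x"] by (simp add: scaleC cinner_scaleC_left)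
  then show ?thesis
    using y complex_eqI by blast
qed

text \<open>\<open>bounded_linear\<close> only means real linearity, while an operator with an
  adjoint for \<open>cinner\<close> must be complex linear; hence the added homogeneity.\<close>

locale bounded_operator = bounded_linear T
  for T :: "'h::complex_hilbert_space \<Rightarrow> 'h" +
  assumes scaleC: "T (scaleC c x) = scaleC c (T x)"
begin

text \<open>Riesz applied to \<open>\<lambda>x. cinner (T x) y\<close> gives the value of an adjoint
  at each \<open>y\<close>, so the choice in \<open>cadjoint\<close> has a witness.\<close>

lemma cinner_cadjoint: "cinner (T x) y = cinner x (cadjoint T y)"
proof -
  obtain K where K: "\<And>x. norm (T x) \<le> norm x * K"
    using pos_bounded by blast
  have "\<exists>z. \<forall>x. cinner (T x) y = cinner x z" for y
  proof (rule riesz_complex)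
    show "cmod (cinner (T x) y) \<le> (K * norm y) * norm x" for x
      using cmod_cinner_le[of "T x" y] mult_right_mono[OF K[of x] norm_ge_zero[of y]]
      by (simp add: mult_ac)
  qed (simp_all add: add scaleC cinner_add_left cinner_scaleC_left)
  then have "\<exists>S. \<forall>x y. cinner (T x) y = cinner x (S y)"
    by metis
  then show ?thesis
    unfolding cadjoint_def by (rule someI2_ex) blast
qed

lemma cinner_cadjoint': "cinner (cadjoint T x) y = cinner x (T y)"
  by (metis cinner_cadjoint cinner_commute)

text \<open>Testing the adjoint identity at \<open>cadjoint T y\<close> bounds the square of its
  norm by \<open>onorm T * norm (cadjoint T y) * norm y\<close>; one factor cancels.\<close>

lemma norm_cadjoint_le: "norm (cadjoint T y) \<le> onorm T * norm y"
proof (cases "cadjoint T y = 0")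
  case True
  then show ?thesis
    by (simp add: onorm_pos_le bounded_linear_axioms)
next
  case False
  let ?z = "cadjoint T y"
  have "(norm ?z)\<^sup>2 = cmod (cinner (T ?z) y)"
    unfolding cinner_cadjoint cmod_cinner_self ..
  also have "\<dots> \<le> norm (T ?z) * norm y"
    by (rule cmod_cinner_le)
  also have "\<dots> \<le> (onorm T * norm ?z) * norm y"
    by (intro mult_right_mono onorm bounded_linear_axioms) auto
  finally show ?thesis
    using False by (simp add: power2_eq_square mult_ac)
qed

lemma bounded_operator_cadjoint: "bounded_operator (cadjoint T)"
proof
  show "cadjoint T (x + y) = cadjoint T x + cadjoint T y" for x y
    by (rule cinner_ext) (simp add: cinner_cadjoint' cinner_add_left)
  show scale: "cadjoint T (scaleC c x) = scaleC c (cadjoint T x)" for c x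
    by (rule cinner_ext) (simp add: cinner_cadjoint' cinner_scaleC_left)
  show "cadjoint T (r *\<^sub>R x) = r *\<^sub>R cadjoint T x" for r x
    by (metis scale scaleC_of_real)
  show "\<exists>K. \<forall>x. norm (cadjoint T x) \<le> norm x * K"
    using norm_cadjoint_le by (metis mult.commute)
qed

end

lemma bounded_operator_comp:
  assumes "bounded_operator S" "bounded_operator T"
  shows "bounded_operator (\<lambda>x. S (T x))"
proof -
  interpret S: bounded_operator S by fact
  interpret T: bounded_operator T by fact
  show ?thesis
    by (intro bounded_operator.intro bounded_operator_axioms.intro
        bounded_linear_compose[OF S.bounded_linear_axioms T.bounded_linear_axioms])
      (simp add: S.scaleC T.scaleC)
qed

section \<open>Weak expectations\<close>

text \<open>The averaged form \<open>B g h\<close> is bounded by \<open>K * norm g * norm h\<close>,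
  so Riesz represents it in its second argument, and the representing vectors make up the operator
  \<open>S\<close>.\<close>

lemma exists_weak_expectation:
  fixes T :: "'w \<Rightarrow> 'h \<Rightarrow> 'h::complex_hilbert_space"
  assumes "prob_space P"
    and op: "\<And>\<omega>. bounded_operator (T \<omega>)"
    and meas: "\<And>g h. (\<lambda>\<omega>. cinner (T \<omega> g) h) \<in> borel_measurable P"
    and bound: "\<And>\<omega> g. norm (T \<omega> g) \<le> K * norm g"
  shows "\<exists>S. has_weak_expectation P T S"
proof -
  interpret prob_space P by fact
  interpret T: bounded_operator "T \<omega>" for \<omega> by (rule op)
  define B where "B g h = (LINT \<omega>|P. cinner (T \<omega> g) h)" for g h
  have cmod_le: "cmod (cinner (T \<omega> g) h) \<le> K * norm g * norm h" for \<omega> g h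
    using cmod_cinner_le[of "T \<omega> g" h] mult_right_mono[OF bound[of \<omega> g] norm_ge_zero[of h]] by simp
  have int: "integrable P (\<lambda>\<omega>. cinner (T \<omega> g) h)" for g h
    by (rule integrable_const_bound[where B = "K * norm g * norm h"]) (use cmod_le meas in auto)
  have cmod_B: "cmod (B g h) \<le> K * norm g * norm h" for g h
  proof -
    have "cmod (B g h) \<le> (LINT \<omega>|P. cmod (cinner (T \<omega> g) h))"
      unfolding B_def by (rule integral_norm_bound)
    also have "\<dots> \<le> (LINT \<omega>|P. K * norm g * norm h)"
      by (intro integral_mono integrable_norm int) (use cmod_le in auto)
    finally show ?thesis
      by (simp add: prob_space)
  qed
  \<comment> \<open>\<open>B g\<close> is conjugate linear in \<open>h\<close>, whereas Riesz
    concerns linear functionals; hence \<open>cnj\<close>.\<close>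
  have "\<exists>y. \<forall>h. cnj (B g h) = cinner h y" for g
  proof (rule riesz_complex)
    show "cmod (cnj (B g h)) \<le> (K * norm g) * norm h" for h
      using cmod_B by simp
  qed (use int in \<open>simp_all add: B_def cinner_add_right cinner_scaleC_right\<close>)
  then obtain S where "\<And>g h. cnj (B g h) = cinner h (S g)"
    by metis
  then have S: "cinner (S g) h = B g h" for g h
    by (metis cinner_commute complex_cnj_cnj)
  have "bounded_linear S"
  proof (rule bounded_linear_intro)
    show "S (x + y) = S x + S y" for x y
      by (rule cinner_ext) (use int in \<open>simp add: S B_def T.add cinner_add_left\<close>)
    show "S (r *\<^sub>R x) = r *\<^sub>R S x" for r x
      unfolding scaleC_of_real[symmetric]
      by (rule cinner_ext) (use int in \<open>simp add: S B_def T.scaleC cinner_scaleC_left\<close>)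
    show "norm (S x) \<le> norm x * K" for x
    proof (cases "S x = 0")
      \<comment> \<open>What remains is \<open>0 \<le> K * norm x\<close>, which follows from
        \<open>bound\<close> at any \<omega>.\<close>
      case True
      then show ?thesis
        using order_trans[OF norm_ge_zero bound[of _ x]] by (simp add: mult.commute)
    next
      case False
      have "(norm (S x))\<^sup>2 = cmod (B x (S x))"
        unfolding S[symmetric] cmod_cinner_self ..
      then have "norm (S x) * norm (S x) \<le> (K * norm x) * norm (S x)"
        using cmod_B[of x "S x"] by (simp add: power2_eq_square)
      then show ?thesis
        using False by (simp add: mult.commute)
    qed
  qed
  moreover have "cinner (S g) h = (LINT \<omega>|completion P. cinner (T \<omega> g) h)" for g h
    using meas by (simp add: S B_def integral_completion)
  moreover have "integrable (completion P) (\<lambda>\<omega>. cinner (T \<omega> g) h)" for g h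
    using int meas by (simp add: integrable_completion)
  ultimately show ?thesis
    unfolding has_weak_expectation_def by blast
qed

text \<open>The preimages of a Borel set under the two matrix coefficients differ by a null set of
  the completion, so measurability passes from one family to the other, and then the integrals
  agree.\<close>

lemma has_weak_expectation_cong_AE:
  assumes "AE \<omega> in P. T \<omega> = T' \<omega>"
  shows "has_weak_expectation P T S \<longleftrightarrow> has_weak_expectation P T' S"
proof -
  have "has_weak_expectation P T' S"
    if ae: "AE \<omega> in P. T \<omega> = T' \<omega>" and T: "has_weak_expectation P T S" for T T'
    unfolding has_weak_expectation_def
  proof (intro conjI allI)
    show "bounded_linear S"
      using T by (simp add: has_weak_expectation_def)
    fix g h
    have int: "integrable (completion P) (\<lambda>\<omega>. cinner (T \<omega> g) h)"
      using T by (simp add: has_weak_expectation_def)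
    have ae': "AE \<omega> in completion P. cinner (T \<omega> g) h = cinner (T' \<omega> g) h"
      using AE_completion[OF ae] by eventually_elim simp
    have meas: "(\<lambda>\<omega>. cinner (T' \<omega> g) h) \<in> borel_measurable (completion P)"
    proof (rule measurableI)
      fix A :: "complex set" assume "A \<in> sets borel"
      show "(\<lambda>\<omega>. cinner (T' \<omega> g) h) -` A \<inter> space (completion P) \<in> sets (completion P)"
      proof (rule completion.in_sets_AE)
        show "AE \<omega> in completion P.
            \<omega> \<in> (\<lambda>\<omega>. cinner (T \<omega> g) h) -` A \<inter> space (completion P) \<longleftrightarrow>
            \<omega> \<in> (\<lambda>\<omega>. cinner (T' \<omega> g) h) -` A \<inter> space (completion P)"
          using ae' by eventually_elim simp
        show "(\<lambda>\<omega>. cinner (T \<omega> g) h) -` A \<inter> space (completion P) \<in> sets (completion P)"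
          by (rule measurable_sets[OF borel_measurable_integrable[OF int] \<open>A \<in> sets borel\<close>])
      qed simp
    qed simp
    show "integrable (completion P) (\<lambda>\<omega>. cinner (T' \<omega> g) h)"
      by (rule integrable_cong_AE_imp[OF int meas]) (use ae' in eventually_elim, simp)
    show "cinner (S g) h = (LINT \<omega>|completion P. cinner (T' \<omega> g) h)"
      using T integral_cong_AE[OF borel_measurable_integrable[OF int] meas ae']
      by (simp add: has_weak_expectation_def)
  qed
  moreover have "AE \<omega> in P. T' \<omega> = T \<omega>"
    using assms by eventually_elim simp
  ultimately show ?thesis
    using assms by blast
qed

lemma bounded_operator_weak_expectation:
  assumes "has_weak_expectation P T S" "\<And>\<omega>. bounded_operator (T \<omega>)"
  shows "bounded_operator S"
proof (intro bounded_operator.intro bounded_operator_axioms.intro)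
  show "bounded_linear S"
    using assms by (simp add: has_weak_expectation_def)
  interpret T: bounded_operator "T \<omega>" for \<omega> by fact
  show "S (scaleC c x) = scaleC c (S x)" for c x
    using assms(1)
    by (intro cinner_ext) (simp add: has_weak_expectation_def cinner_scaleC_left T.scaleC)
qed

section \<open>Committee spaces\<close>

context committee_space
begin

abbreviation e :: "'m \<Rightarrow> 'h" where "e \<equiv> monomial_vec coef"

lemma coef_monomial: "coef (e \<alpha>) \<beta> = (if \<beta> = \<alpha> then 1 else 0)"
proof -
  have "coef (e \<alpha>) = (\<lambda>\<beta>. if \<beta> = \<alpha> then 1 else 0)"
    unfolding monomial_vec_def by (intro f_inv_into_f polynomial_in_range) simp
  then show ?thesis
    by simp
qed

lemma coef_zero [simp]: "coef 0 \<alpha> = 0"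
  using coeff_scaleC[of 0 0 \<alpha>] by simp

lemma coef_sum: "coef (\<Sum>i\<in>A. f i) \<alpha> = (\<Sum>i\<in>A. coef (f i) \<alpha>)"
  by (induction A rule: infinite_finite_induct) (auto simp: coeff_add)

lemma coef_diff: "coef (x - y) \<alpha> = coef x \<alpha> - coef y \<alpha>"
  by (metis add_diff_cancel coeff_add diff_add_cancel)

lemma coef_ext: "(\<And>\<alpha>. coef x \<alpha> = coef y \<alpha>) \<Longrightarrow> x = y"
  using inj_coeff by (meson ext injD)

lemma norm_monomial_pos: "norm (e \<alpha>) > 0"
  using coef_monomial[of \<alpha> \<alpha>] by auto

lemma cinner_monomials: "cinner (e \<alpha>) (e \<beta>) = (if \<alpha> = \<beta> then of_real ((norm (e \<alpha>))\<^sup>2) else 0)"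
  by (simp add: monomials_orthogonal cinner_self)

lemma coef_monomial_sum:
  assumes "finite A"
  shows "coef (\<Sum>\<alpha>\<in>A. scaleC (c \<alpha>) (e \<alpha>)) \<beta> = (if \<beta> \<in> A then c \<beta> else 0)"
  using assms by (simp add: coef_sum coeff_scaleC coef_monomial if_distrib[of "(*) _"] cong: if_cong)

lemma polynomial_expansion:
  assumes "finite A" "{\<alpha>. coef x \<alpha> \<noteq> 0} \<subseteq> A"
  shows "x = (\<Sum>\<alpha>\<in>A. scaleC (coef x \<alpha>) (e \<alpha>))"
  by (rule coef_ext) (use assms in \<open>auto simp: coef_monomial_sum\<close>)

section \<open>Density of polynomials, monomial expansions and Parseval's identity\<close>

lemma polynomial_dense_induct [case_names closed polynomial]:
  assumes "closed {x. Q x}" and "\<And>x. finite {\<alpha>. coef x \<alpha> \<noteq> 0} \<Longrightarrow> Q x"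
  shows "Q x"
proof -
  have "closure {x. finite {\<alpha>. coef x \<alpha> \<noteq> 0}} \<subseteq> {x. Q x}"
    using assms by (intro closure_minimal) auto
  then show ?thesis
    unfolding polynomials_dense by blast
qed

text \<open>Both sides are continuous in \<open>x\<close>, the right one by continuity of the
  coefficient functionals, so it suffices to check polynomials.\<close>

lemma cinner_monomial: "cinner x (e \<alpha>) = coef x \<alpha> * of_real ((norm (e \<alpha>))\<^sup>2)"
proof (induct x rule: polynomial_dense_induct)
  show "closed {x. cinner x (e \<alpha>) = coef x \<alpha> * of_real ((norm (e \<alpha>))\<^sup>2)}"
    by (intro closed_Collect_eq continuous_on_cinner continuous_intros continuous_coeff)
next
  case fin: (polynomial x)
  \<comment> \<open>\<open>insert \<alpha>\<close> covers the case
    \<open>coef x \<alpha> = 0\<close>, where \<alpha> is outside the support.\<close>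
  have "cinner x (e \<alpha>)
      = cinner (\<Sum>\<beta>\<in>insert \<alpha> {\<alpha>. coef x \<alpha> \<noteq> 0}. scaleC (coef x \<beta>) (e \<beta>)) (e \<alpha>)"
    using fin by (subst polynomial_expansion[of "insert \<alpha> {\<alpha>. coef x \<alpha> \<noteq> 0}" x]) auto
  also have "\<dots> = coef x \<alpha> * of_real ((norm (e \<alpha>))\<^sup>2)"
    using fin by (simp add: cinner_sum_left cinner_scaleC_left cinner_monomials
        if_distrib[of "(*) _"] sum.delta cong: if_cong del: sum.insert of_real_power)
  finally show "cinner x (e \<alpha>) = coef x \<alpha> * of_real ((norm (e \<alpha>))\<^sup>2)" .
qed

lemma coef_eq: "coef x \<alpha> = cinner x (e \<alpha>) / of_real ((norm (e \<alpha>))\<^sup>2)"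
  using norm_monomial_pos[of \<alpha>] by (simp add: cinner_monomial)

text \<open>Partial sums are orthogonal projections: once \<open>A\<close> contains the support of a
  polynomial \<open>p\<close> close to \<open>x\<close>, the sum over \<open>A\<close> is at least
  as close to \<open>x\<close> as \<open>p\<close> is.\<close>

lemma monomial_expansion: "((\<lambda>\<alpha>. scaleC (coef x \<alpha>) (e \<alpha>)) has_sum x) UNIV"
  unfolding has_sum_def
proof (rule tendstoI)
  fix \<epsilon> :: real assume "\<epsilon> > 0"
  have "x \<in> closure {x. finite {\<alpha>. coef x \<alpha> \<noteq> 0}}"
    by (simp add: polynomials_dense)
  then obtain p where p: "finite {\<alpha>. coef p \<alpha> \<noteq> 0}" "dist p x < \<epsilon>"
    using \<open>\<epsilon> > 0\<close> unfolding closure_approachable by blast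
  have "dist (\<Sum>\<alpha>\<in>A. scaleC (coef x \<alpha>) (e \<alpha>)) x < \<epsilon>"
    if A: "finite A" "{\<alpha>. coef p \<alpha> \<noteq> 0} \<subseteq> A" for A
  proof -
    define s where "s = (\<Sum>\<alpha>\<in>A. scaleC (coef x \<alpha>) (e \<alpha>))"
    have orth: "cinner (x - s) (e \<alpha>) = 0" if "\<alpha> \<in> A" for \<alpha>
      using that A by (simp add: cinner_monomial coef_diff s_def coef_monomial_sum)
    have "s - p = (\<Sum>\<alpha>\<in>A. scaleC (coef (s - p) \<alpha>) (e \<alpha>))"
      by (rule polynomial_expansion) (use A in \<open>auto simp: coef_diff s_def coef_monomial_sum\<close>)
    \<comment> \<open>\<open>s - p\<close> lies in the span of the monomials indexed by
      \<open>A\<close>, to which \<open>x - s\<close> is orthogonal.\<close>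
    then have "cinner (x - s) (s - p)
        = (\<Sum>\<alpha>\<in>A. cnj (coef (s - p) \<alpha>) * cinner (x - s) (e \<alpha>))"
      by (metis (no_types, lifting) cinner_scaleC_right cinner_sum_right sum.cong)
    then have "cinner (x - s) (s - p) = 0"
      using orth by simp
    then have "cinner (x - s) (x - s) = cinner (x - s) (x - p)"
      using cinner_add_right[of "x - s" "x - s" "s - p"] by simp
    then have "(norm (x - s))\<^sup>2 \<le> norm (x - s) * norm (x - p)"
      using cmod_cinner_le[of "x - s" "x - p"] by (metis cmod_cinner_self)
    then have "norm (x - s) \<le> norm (x - p)"
      by (cases "x = s") (auto simp: power2_eq_square)
    then show ?thesis
      using p by (simp add: dist_norm norm_minus_commute s_def)
  qed
  then show "\<forall>\<^sub>F A in finite_subsets_at_top UNIV. dist (\<Sum>\<alpha>\<in>A. scaleC (coef x \<alpha>) (e \<alpha>)) x < \<epsilon>"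
    unfolding eventually_finite_subsets_at_top using p(1) by blast
qed

lemma parseval:
  "((\<lambda>\<alpha>. coef x \<alpha> * cnj (coef y \<alpha>) * of_real ((norm (e \<alpha>))\<^sup>2)) has_sum cinner x y) UNIV"
proof -
  have *: "cinner (e \<alpha>) y = cnj (coef y \<alpha>) * of_real ((norm (e \<alpha>))\<^sup>2)" for \<alpha>
    by (metis cinner_commute cinner_monomial complex_cnj_complex_of_real complex_cnj_mult)
  show ?thesis
    using has_sum_bounded_linear[OF bounded_bilinear.bounded_linear_left[OF bounded_bilinear_cinner]
        monomial_expansion[of x], of y]
    by (simp add: cinner_scaleC_left * mult.assoc)
qed

text \<open>The left side is a finite partial sum of Parseval's identity for \<open>x\<close> with
  itself, whose terms are nonnegative.\<close>

lemma bessel: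
  assumes "finite A"
  shows "(\<Sum>\<alpha>\<in>A. (cmod (coef x \<alpha>))\<^sup>2 * (norm (e \<alpha>))\<^sup>2) \<le> (norm x)\<^sup>2"
proof -
  have "((\<lambda>\<alpha>. (cmod (coef x \<alpha>))\<^sup>2 * (norm (e \<alpha>))\<^sup>2) has_sum (norm x)\<^sup>2) UNIV"
    using has_sum_bounded_linear[OF bounded_linear_Re parseval, of x x]
    by (simp add: cinner_self flip: complex_norm_square of_real_power of_real_mult)
  then show ?thesis
    using assms by (intro finite_sum_le_has_sum) auto
qed

text \<open>Parseval's sum converges along the finite index sets, while measurability passes to
  limits of sequences; an enumeration of the indices supplies a cofinal sequence of finite
  sets.\<close>

lemma borel_measurable_cinner:
  assumes countable: "countable (UNIV :: 'm set)"
    and meas: "\<And>\<alpha>. (\<lambda>\<omega>. coef (X \<omega>) \<alpha>) \<in> borel_measurable P"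
      "\<And>\<alpha>. (\<lambda>\<omega>. coef (Y \<omega>) \<alpha>) \<in> borel_measurable P"
  shows "(\<lambda>\<omega>. cinner (X \<omega>) (Y \<omega>)) \<in> borel_measurable P"
proof -
  let ?term = "\<lambda>\<omega> \<alpha>. coef (X \<omega>) \<alpha> * cnj (coef (Y \<omega>) \<alpha>) * complex_of_real ((norm (e \<alpha>))\<^sup>2)"
  define A :: "nat \<Rightarrow> 'm set" where "A n = {\<alpha>. to_nat_on UNIV \<alpha> < n}" for n
  have fin: "finite (A n)" for n
    using finite_vimageI[OF finite_lessThan[of n] inj_on_to_nat_on[OF countable]]
    by (simp add: A_def vimage_def lessThan_def)
  have "filterlim A (finite_subsets_at_top UNIV) sequentially"
    unfolding filterlim_finite_subsets_at_top
  proof (intro allI impI)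
    fix F :: "'m set" assume "finite F \<and> F \<subseteq> UNIV"
    then have F: "finite F" ..
    \<comment> \<open>\<open>insert 0\<close> keeps \<open>Max\<close> meaningful for empty
      \<open>F\<close>.\<close>
    have "F \<subseteq> A n" if "n > Max (insert 0 (to_nat_on UNIV ` F))" for n
      using that F unfolding A_def by (auto simp: Max_less_iff)
    then show "\<forall>\<^sub>F n in sequentially. finite (A n) \<and> F \<subseteq> A n \<and> A n \<subseteq> UNIV"
      using fin by (intro eventually_mono[OF eventually_gt_at_top]) auto
  qed
  then have "(\<lambda>n. \<Sum>\<alpha>\<in>A n. ?term \<omega> \<alpha>) \<longlonglongrightarrow> cinner (X \<omega>) (Y \<omega>)" for \<omega>
    using filterlim_compose[OF parseval[unfolded has_sum_def]] by blast
  then show ?thesis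
  proof (rule borel_measurable_LIMSEQ_metric[rotated])
    show "(\<lambda>\<omega>. \<Sum>\<alpha>\<in>A n. ?term \<omega> \<alpha>) \<in> borel_measurable P" for n
      by (intro borel_measurable_sum borel_measurable_times meas borel_measurable_const
          borel_measurable_continuous_on[OF continuous_on_cnj[OF continuous_on_id]])
  qed
qed

text \<open>On a polynomial, Pythagoras compares \<open>S x\<close> with \<open>x\<close> term by
  term; the inequality is a closed condition, so density extends it to all \<open>x\<close>.\<close>

lemma onorm_diagonal_le:
  assumes "bounded_operator S" and diag: "\<And>\<alpha>. S (e \<alpha>) = scaleC (r \<alpha>) (e \<alpha>)"
    and le: "\<And>\<alpha>. cmod (r \<alpha>) \<le> K"
  shows "onorm S \<le> K"
proof (rule onorm_bound)
  interpret S: bounded_operator S by fact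
  show "0 \<le> K"
    using le norm_ge_zero order_trans by blast
  show "norm (S x) \<le> K * norm x" for x
  proof (induct x rule: polynomial_dense_induct)
    show "closed {x. norm (S x) \<le> K * norm x}"
      by (intro closed_Collect_le continuous_intros S.continuous_on)
  next
    case fin: (polynomial x)
    let ?A = "{\<alpha>. coef x \<alpha> \<noteq> 0}"
    have x: "x = (\<Sum>\<alpha>\<in>?A. scaleC (coef x \<alpha>) (e \<alpha>))"
      by (rule polynomial_expansion) (use fin in auto)
    have orth: "cinner (scaleC a (e \<alpha>)) (scaleC b (e \<beta>)) = 0" if "\<alpha> \<noteq> \<beta>" for a b \<alpha> \<beta>
      using that by (simp add: cinner_scaleC_left cinner_scaleC_right cinner_monomials)
    have "S x = (\<Sum>\<alpha>\<in>?A. scaleC (coef x \<alpha> * r \<alpha>) (e \<alpha>))"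
      using arg_cong[OF x, of S] by (simp only: S.sum S.scaleC diag scaleC_scaleC)
    then have "(norm (S x))\<^sup>2 = (\<Sum>\<alpha>\<in>?A. (norm (scaleC (coef x \<alpha> * r \<alpha>) (e \<alpha>)))\<^sup>2)"
      using fin by (simp add: norm_sum_orthogonal orth del: norm_scaleC)
    also have "\<dots> \<le> (\<Sum>\<alpha>\<in>?A. K\<^sup>2 * (norm (scaleC (coef x \<alpha>) (e \<alpha>)))\<^sup>2)"
    proof (rule sum_mono)
      fix \<alpha>
      have "(cmod (r \<alpha>))\<^sup>2 \<le> K\<^sup>2"
        using le by (intro power_mono) auto
      then show "(norm (scaleC (coef x \<alpha> * r \<alpha>) (e \<alpha>)))\<^sup>2
          \<le> K\<^sup>2 * (norm (scaleC (coef x \<alpha>) (e \<alpha>)))\<^sup>2"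
        using mult_right_mono[of "(cmod (r \<alpha>))\<^sup>2" "K\<^sup>2" "(cmod (coef x \<alpha>) * norm (e \<alpha>))\<^sup>2"]
        by (simp add: norm_mult power_mult_distrib mult_ac)
    qed
    also have "\<dots> = K\<^sup>2 * (norm (\<Sum>\<alpha>\<in>?A. scaleC (coef x \<alpha>) (e \<alpha>)))\<^sup>2"
      using fin by (simp add: norm_sum_orthogonal orth sum_distrib_left del: norm_scaleC)
    also have "\<dots> = (K * norm x)\<^sup>2"
      unfolding power_mult_distrib x[symmetric] ..
    finally have "(norm (S x))\<^sup>2 \<le> (K * norm x)\<^sup>2" .
    then show "norm (S x) \<le> K * norm x"
      by (rule power2_le_imp_le) (use \<open>0 \<le> K\<close> in simp)
  qed
qed

end

section \<open>Random multipliers\<close>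

text \<open>For a multiplier the product series lies in the range of \<open>coef\<close>, so
  \<open>inv coef\<close> in \<open>mult_op\<close> returns the vector with these coefficients.
  Homogeneity is then checked coefficientwise.\<close>

lemma bounded_operator_mult_op:
  assumes "power_series_hilbert_space coef" "multiplier add coef f"
  shows "coef (mult_op add coef f h) \<gamma> = series_mult add f (coef h) \<gamma>"
    and "bounded_operator (mult_op add coef f)"
proof -
  interpret power_series_hilbert_space coef by fact
  show coef_M: "coef (mult_op add coef f h) \<gamma> = series_mult add f (coef h) \<gamma>" for h \<gamma>
    using assms by (simp add: mult_op_def multiplier_def f_inv_into_f)
  show "bounded_operator (mult_op add coef f)"
  proof (rule bounded_operator.intro)
    show "bounded_linear (mult_op add coef f)"
      using assms by (simp add: multiplier_def)
    show "bounded_operator_axioms (mult_op add coef f)"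
    proof
      fix c h
      have "coef (mult_op add coef f (scaleC c h)) = coef (scaleC c (mult_op add coef f h))"
        by (rule ext) (simp add: coef_M coeff_scaleC series_mult_def sum_distrib_left split_def mult_ac)
      then show "mult_op add coef f (scaleC c h) = scaleC c (mult_op add coef f h)"
        by (rule injD[OF inj_coeff])
    qed
  qed
qed

text \<open>Common ground of finitely supported exponents and words. Finiteness makes the Cauchy
  product a genuine sum, cancellation makes factorisations of one index differ in their first
  factor, and \<open>zero\<close> indexes the constant series 1.\<close>

locale cancellative_multi_index =
  fixes add :: "'m \<Rightarrow> 'm \<Rightarrow> 'm" and zero :: 'm
  assumes finite_factorisations: "finite {(\<alpha>, \<beta>). add \<alpha> \<beta> = \<gamma>}"
    and add_left_cancel: "add \<alpha> \<beta> = add \<alpha> \<beta>' \<Longrightarrow> \<beta> = \<beta>'"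
    and add_zero_right: "add \<alpha> zero = \<alpha>"

text \<open>The random model after correction on a null set: the multiplier property and the bound
  \<open>K\<close> hold at every \<omega>, so every \<open>M \<omega>\<close> is a bounded
  operator.\<close>

locale uniform_multiplier_model =
  cancellative_multi_index add zero + committee_space add coef + prob_space P
  for add :: "'m \<Rightarrow> 'm \<Rightarrow> 'm" and zero
    and coef :: "'h::complex_hilbert_space \<Rightarrow> 'm \<Rightarrow> complex"
    and P :: "'w measure"
    and v :: "'m \<Rightarrow> 'w \<Rightarrow> complex" +
  fixes K :: real
  assumes random_variable_v: "v \<gamma> \<in> borel_measurable P"
    and square_integrable: "integrable P (\<lambda>\<omega>. (cmod (v \<gamma> \<omega>))\<^sup>2)"
    and uncorrelated: "\<gamma> \<noteq> \<gamma>' \<Longrightarrow> (LINT \<omega>|P. cnj (v \<gamma> \<omega>) * v \<gamma>' \<omega>) = 0"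
    and multiplier_v: "multiplier add coef (\<lambda>\<gamma>. v \<gamma> \<omega>)"
    and onorm_le: "onorm (mult_op add coef (\<lambda>\<gamma>. v \<gamma> \<omega>)) \<le> K"
begin

abbreviation facs :: "'m \<Rightarrow> ('m \<times> 'm) set" where "facs \<gamma> \<equiv> {(\<alpha>, \<beta>). add \<alpha> \<beta> = \<gamma>}"

definition M :: "'w \<Rightarrow> 'h \<Rightarrow> 'h" where "M \<omega> = mult_op add coef (\<lambda>\<gamma>. v \<gamma> \<omega>)"

definition w :: "'m \<Rightarrow> real" where "w \<gamma> = (LINT \<omega>|P. (cmod (v \<gamma> \<omega>))\<^sup>2)"

lemma coef_M: "coef (M \<omega> h) \<gamma> = (\<Sum>(\<alpha>, \<beta>)\<in>facs \<gamma>. v \<alpha> \<omega> * coef h \<beta>)"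
  unfolding M_def bounded_operator_mult_op(1)[OF power_series_hilbert_space_axioms multiplier_v]
  by (simp add: series_mult_def)

sublocale M: bounded_operator "M \<omega>" for \<omega>
  unfolding M_def by (rule bounded_operator_mult_op(2)[OF power_series_hilbert_space_axioms multiplier_v])

abbreviation M_adj :: "'w \<Rightarrow> 'h \<Rightarrow> 'h" where "M_adj \<omega> \<equiv> cadjoint (M \<omega>)"

sublocale M_adj: bounded_operator "M_adj \<omega>" for \<omega>
  by (rule M.bounded_operator_cadjoint)

lemma norm_M_le: "norm (M \<omega> h) \<le> K * norm h"
  using onorm[OF M.bounded_linear_axioms, of \<omega> h] mult_right_mono[OF onorm_le norm_ge_zero]
  unfolding M_def by (rule order_trans)

lemma norm_M_adj_le: "norm (M_adj \<omega> h) \<le> K * norm h"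
  using M.norm_cadjoint_le[of \<omega> h] mult_right_mono[OF onorm_le norm_ge_zero]
  unfolding M_def by (rule order_trans)

lemma K_nonneg: "0 \<le> K"
proof -
  have "0 \<le> K * norm (e zero)"
    using order_trans[OF norm_ge_zero norm_M_le] .
  then show ?thesis
    using norm_monomial_pos[of zero] by (simp add: zero_le_mult_iff)
qed

lemma is_row_expectation_iff:
  "is_row_expectation add coef P v R \<longleftrightarrow> has_weak_expectation P (\<lambda>\<omega> g. M \<omega> (M_adj \<omega> g)) R"
  by (simp add: is_row_expectation_def M_def Let_def comp_def)

lemma is_column_expectation_iff:
  "is_column_expectation add coef P v C \<longleftrightarrow> has_weak_expectation P (\<lambda>\<omega> g. M_adj \<omega> (M \<omega> g)) C"
  by (simp add: is_column_expectation_def M_def Let_def comp_def)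

section \<open>Measurability and existence of the expectations\<close>

lemma measurable_coef_M: "(\<lambda>\<omega>. coef (M \<omega> h) \<gamma>) \<in> borel_measurable P"
  unfolding coef_M split_def
  by (intro borel_measurable_sum borel_measurable_times random_variable_v borel_measurable_const)

lemma coef_M_adj: "coef (M_adj \<omega> h) \<beta> = cinner h (M \<omega> (e \<beta>)) / of_real ((norm (e \<beta>))\<^sup>2)"
  by (simp only: coef_eq[of "M_adj \<omega> h"] M.cinner_cadjoint')

text \<open>A coefficient of \<open>M_adj \<omega> h\<close> is a rescaled inner product of the
  fixed vector \<open>h\<close> with \<open>M \<omega> (e \<gamma>)\<close>, whose coefficients are
  finite sums of multiples of the random variables.\<close>

lemma measurable_coef_M_adj:
  assumes "countable (UNIV :: 'm set)"
  shows "(\<lambda>\<omega>. coef (M_adj \<omega> h) \<gamma>) \<in> borel_measurable P"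
  unfolding coef_M_adj
  by (intro borel_measurable_divide borel_measurable_const borel_measurable_cinner assms measurable_coef_M)

lemmas bounded_operator_row = bounded_operator_comp[OF M.bounded_operator_axioms M_adj.bounded_operator_axioms]
  and bounded_operator_column = bounded_operator_comp[OF M_adj.bounded_operator_axioms M.bounded_operator_axioms]

lemma exists_row_expectation:
  assumes "countable (UNIV :: 'm set)"
  shows "\<exists>R. is_row_expectation add coef P v R"
  unfolding is_row_expectation_iff
proof (rule exists_weak_expectation)
  show "(\<lambda>\<omega>. cinner (M \<omega> (M_adj \<omega> g)) h) \<in> borel_measurable P" for g h
    unfolding M.cinner_cadjoint
    by (intro borel_measurable_cinner assms measurable_coef_M_adj)
  show "norm (M \<omega> (M_adj \<omega> g)) \<le> (K * K) * norm g" for \<omega> g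
    using norm_M_le[of \<omega> "M_adj \<omega> g"] mult_left_mono[OF norm_M_adj_le K_nonneg, of \<omega> g]
    by (simp add: mult.assoc)
qed (rule prob_space_axioms bounded_operator_row)+

lemma exists_column_expectation:
  assumes "countable (UNIV :: 'm set)"
  shows "\<exists>C. is_column_expectation add coef P v C"
  unfolding is_column_expectation_iff
proof (rule exists_weak_expectation)
  show "(\<lambda>\<omega>. cinner (M_adj \<omega> (M \<omega> g)) h) \<in> borel_measurable P" for g h
    unfolding M.cinner_cadjoint'
    by (intro borel_measurable_cinner assms measurable_coef_M)
  show "norm (M_adj \<omega> (M \<omega> g)) \<le> (K * K) * norm g" for \<omega> g
    using norm_M_adj_le[of \<omega> "M \<omega> g"] mult_left_mono[OF norm_M_le K_nonneg, of \<omega> g]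
    by (simp add: mult.assoc)
qed (rule prob_space_axioms bounded_operator_column)+

section \<open>Second moments and the eigenvalues of the row expectation\<close>

lemma integrable_v_v: "integrable P (\<lambda>\<omega>. cnj (v \<alpha> \<omega>) * v \<beta> \<omega>)"
proof (rule Bochner_Integration.integrable_bound)
  show "integrable P (\<lambda>\<omega>. (cmod (v \<alpha> \<omega>))\<^sup>2 + (cmod (v \<beta> \<omega>))\<^sup>2)"
    by (intro Bochner_Integration.integrable_add square_integrable)
  show "(\<lambda>\<omega>. cnj (v \<alpha> \<omega>) * v \<beta> \<omega>) \<in> borel_measurable P"
    by (intro borel_measurable_times random_variable_v
        borel_measurable_continuous_on[OF continuous_on_cnj[OF continuous_on_id]])
  show "AE \<omega> in P. norm (cnj (v \<alpha> \<omega>) * v \<beta> \<omega>) \<le> norm ((cmod (v \<alpha> \<omega>))\<^sup>2 + (cmod (v \<beta> \<omega>))\<^sup>2)"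
  proof (rule AE_I2)
    fix \<omega>
    \<comment> \<open>The square bounds twice the product; nonnegativity of the product removes the
      factor 2.\<close>
    have "0 \<le> (cmod (v \<alpha> \<omega>) - cmod (v \<beta> \<omega>))\<^sup>2" "0 \<le> cmod (v \<alpha> \<omega>) * cmod (v \<beta> \<omega>)"
      by simp_all
    then have "cmod (v \<alpha> \<omega>) * cmod (v \<beta> \<omega>) \<le> (cmod (v \<alpha> \<omega>))\<^sup>2 + (cmod (v \<beta> \<omega>))\<^sup>2"
      unfolding power2_diff by linarith
    then show "norm (cnj (v \<alpha> \<omega>) * v \<beta> \<omega>) \<le> norm ((cmod (v \<alpha> \<omega>))\<^sup>2 + (cmod (v \<beta> \<omega>))\<^sup>2)"
      by (simp add: norm_mult)
  qed
qed

lemma expectation_v_v: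
  "(LINT \<omega>|P. cnj (v \<alpha> \<omega>) * v \<beta> \<omega>) = (if \<alpha> = \<beta> then of_real (w \<alpha>) else 0)"
proof (cases "\<alpha> = \<beta>")
  case True
  have "cnj (v \<alpha> \<omega>) * v \<alpha> \<omega> = of_real ((cmod (v \<alpha> \<omega>))\<^sup>2)" for \<omega>
    using complex_norm_square[of "v \<alpha> \<omega>"] by (simp add: mult.commute)
  with True show ?thesis
    by (simp add: w_def del: of_real_power)
qed (use uncorrelated in simp)

lemma w_nonneg: "0 \<le> w \<gamma>"
  by (simp add: w_def)

text \<open>Up to norms, the coefficient at \<beta> is the conjugate of that of
  \<open>M \<omega> (e \<beta>)\<close> at \<delta>. It vanishes unless \<beta> is a right factor of
  \<delta>, which leaves a finite sum.\<close>

lemma M_adj_monomial: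
  "M_adj \<omega> (e \<delta>)
    = (\<Sum>(\<alpha>, \<beta>)\<in>facs \<delta>. scaleC (cnj (v \<alpha> \<omega>) * of_real ((norm (e \<delta>))\<^sup>2 / (norm (e \<beta>))\<^sup>2)) (e \<beta>))"
proof (rule coef_ext)
  fix \<beta>
  have "cinner (e \<delta>) (M \<omega> (e \<beta>)) = cnj (coef (M \<omega> (e \<beta>)) \<delta> * of_real ((norm (e \<delta>))\<^sup>2))"
    by (metis cinner_commute cinner_monomial)
  then show "coef (M_adj \<omega> (e \<delta>)) \<beta>
      = coef (\<Sum>(\<alpha>, \<beta>)\<in>facs \<delta>. scaleC (cnj (v \<alpha> \<omega>) * of_real ((norm (e \<delta>))\<^sup>2 / (norm (e \<beta>))\<^sup>2)) (e \<beta>)) \<beta>"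
    unfolding coef_M_adj
    by (auto simp: coef_M coef_sum coeff_scaleC coef_monomial split_def sum_distrib_right
        sum_divide_distrib intro!: sum.cong)
qed

text \<open>\<open>cinner (R (e \<delta>)) (e \<gamma>)\<close> is the expectation of \<open>cinner
  (M_adj \<omega> (e \<delta>)) (M_adj \<omega> (e \<gamma>))\<close>, a double sum over
  factorisations. Orthogonality of monomials forces equal second factors and uncorrelatedness equal
  first factors, so only identical pairs survive.\<close>

lemma row_expectation_monomial:
  assumes "is_row_expectation add coef P v R"
  shows "R (e \<delta>) = scaleC (\<Sum>(\<alpha>, \<beta>)\<in>facs \<delta>. of_real (w \<alpha> * (norm (e \<delta>))\<^sup>2 / (norm (e \<beta>))\<^sup>2)) (e \<delta>)"
proof (rule coef_ext)
  fix \<gamma>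
  let ?n = "\<lambda>\<alpha>. norm (e \<alpha>)"
  \<comment> \<open>\<open>?c\<close> collects the deterministic part of each term: the norm ratios
    from the two adjoints and the inner product of the second factors.\<close>
  let ?c = "\<lambda>p q. of_real ((?n \<delta>)\<^sup>2 / (?n (snd p))\<^sup>2 * ((?n \<gamma>)\<^sup>2 / (?n (snd q))\<^sup>2)) * cinner (e (snd p)) (e (snd q))"
  have eq: "cinner (M \<omega> (M_adj \<omega> (e \<delta>))) (e \<gamma>)
      = (\<Sum>p\<in>facs \<delta>. \<Sum>q\<in>facs \<gamma>. ?c p q * (cnj (v (fst p) \<omega>) * v (fst q) \<omega>))" for \<omega>
    unfolding M.cinner_cadjoint M_adj_monomial split_def cinner_sum_left
    by (intro sum.cong refl)
      (simp add: cinner_sum_right cinner_scaleC_left cinner_scaleC_right mult_ac)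
  have int: "integrable P (\<lambda>\<omega>. ?c p q * (cnj (v (fst p) \<omega>) * v (fst q) \<omega>))" for p q
    by (intro integrable_mult_right integrable_v_v)
  have meas: "(\<lambda>\<omega>. ?c p q * (cnj (v (fst p) \<omega>) * v (fst q) \<omega>)) \<in> borel_measurable P" for p q
    by (rule borel_measurable_integrable[OF int])
  have summand: "?c p q * (if fst p = fst q then of_real (w (fst p)) else 0)
      = (if q = p then of_real (w (fst p) * (?n \<delta>)\<^sup>2 / (?n (snd p))\<^sup>2 * (?n \<delta>)\<^sup>2) else 0)"
    if "p \<in> facs \<delta>" "q \<in> facs \<gamma>" for p q
  proof (cases "q = p")
    case True
    have cancel: "a / b * (a / b) * b * c = c * a / b * a" if "b \<noteq> 0" for a b c :: complex
      using that by (simp add: field_simps)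
    have "complex_of_real ((?n (snd p))\<^sup>2) \<noteq> 0" "\<gamma> = \<delta>"
      using norm_monomial_pos[of "snd p"] True that by auto
    then show ?thesis
      unfolding True by (simp only: cinner_monomials simp_thms if_True of_real_mult of_real_divide cancel)
  next
    case False
    then show ?thesis
      by (auto simp: cinner_monomials prod_eq_iff)
  qed
  have "cinner (R (e \<delta>)) (e \<gamma>) = (LINT \<omega>|completion P. cinner (M \<omega> (M_adj \<omega> (e \<delta>))) (e \<gamma>))"
    using assms by (simp add: is_row_expectation_iff has_weak_expectation_def)
  also have "\<dots> = (LINT \<omega>|P. cinner (M \<omega> (M_adj \<omega> (e \<delta>))) (e \<gamma>))"
    unfolding eq by (intro integral_completion borel_measurable_sum meas)
  also have "\<dots> = (\<Sum>p\<in>facs \<delta>. \<Sum>q\<in>facs \<gamma>. ?c p q * (if fst p = fst q then of_real (w (fst p)) else 0))"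
    unfolding eq
    by (simp only: Bochner_Integration.integral_sum[OF Bochner_Integration.integrable_sum[OF int]]
        Bochner_Integration.integral_sum[OF int] integral_mult_right_zero expectation_v_v)
  also have "\<dots> = (\<Sum>p\<in>facs \<delta>. \<Sum>q\<in>facs \<gamma>.
      if q = p then of_real (w (fst p) * (?n \<delta>)\<^sup>2 / (?n (snd p))\<^sup>2 * (?n \<delta>)\<^sup>2) else 0)"
    by (intro sum.cong refl summand)
  also have "\<dots> = (\<Sum>p\<in>facs \<delta>.
      if p \<in> facs \<gamma> then of_real (w (fst p) * (?n \<delta>)\<^sup>2 / (?n (snd p))\<^sup>2 * (?n \<delta>)\<^sup>2) else 0)"
    by (simp only: sum.delta[OF finite_factorisations])
  \<comment> \<open>A pair in both \<open>facs \<delta>\<close> and \<open>facs \<gamma>\<close>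
    forces \<gamma> = \<delta>; this is the diagonality of \<open>R\<close>.\<close>
  also have "\<dots> = (if \<gamma> = \<delta> then
      \<Sum>p\<in>facs \<delta>. of_real (w (fst p) * (?n \<delta>)\<^sup>2 / (?n (snd p))\<^sup>2 * (?n \<delta>)\<^sup>2) else 0)"
  proof (cases "\<gamma> = \<delta>")
    case True
    show ?thesis
      unfolding True if_P[OF refl] by (intro sum.cong refl if_P)
  next
    case False
    then show ?thesis
      unfolding if_not_P[OF False] by (intro sum.neutral ballI if_not_P) auto
  qed
  also have "\<dots> = coef (scaleC (\<Sum>p\<in>facs \<delta>. of_real (w (fst p) * (?n \<delta>)\<^sup>2 / (?n (snd p))\<^sup>2)) (e \<delta>)) \<gamma>
      * of_real ((?n \<gamma>)\<^sup>2)"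
    by (simp add: coeff_scaleC coef_monomial sum_distrib_right)
  finally show "coef (R (e \<delta>)) \<gamma>
      = coef (scaleC (\<Sum>(\<alpha>, \<beta>)\<in>facs \<delta>. of_real (w \<alpha> * (?n \<delta>)\<^sup>2 / (?n \<beta>)\<^sup>2)) (e \<delta>)) \<gamma>"
    unfolding coef_eq[of "R (e \<delta>)"] using norm_monomial_pos[of \<gamma>] by (simp add: split_def)
qed

text \<open>\<open>M \<omega>\<close> maps the constant series 1 to the random series itself, so
  Bessel bounds the sum of \<open>(cmod (v \<gamma> \<omega>))\<^sup>2 * (norm (e
  \<gamma>))\<^sup>2\<close> pointwise by \<open>(norm (M \<omega> (e zero)))\<^sup>2\<close>, whose
  expectation is \<open>cinner (C (e zero)) (e zero)\<close>.\<close>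

lemma sum_w_le_onorm_column:
  assumes "is_column_expectation add coef P v C" and unit: "norm (e zero) = 1" and "finite A"
  shows "(\<Sum>\<gamma>\<in>A. w \<gamma> * (norm (e \<gamma>))\<^sup>2) \<le> onorm C"
proof -
  have C: "bounded_linear C"
    "integrable (completion P) (\<lambda>\<omega>. cinner (M_adj \<omega> (M \<omega> (e zero))) (e zero))"
    "cinner (C (e zero)) (e zero) = (LINT \<omega>|completion P. cinner (M_adj \<omega> (M \<omega> (e zero))) (e zero))"
    using assms by (auto simp: is_column_expectation_iff has_weak_expectation_def)
  have coef_M1: "coef (M \<omega> (e zero)) \<gamma> = v \<gamma> \<omega>" for \<omega> \<gamma>
  proof -
    \<comment> \<open>The only factorisation of \<gamma> with second factor \<open>zero\<close> is
      \<open>(\<gamma>, zero)\<close>.\<close>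
    have "coef (M \<omega> (e zero)) \<gamma> = (\<Sum>p\<in>facs \<gamma>. if p = (\<gamma>, zero) then v \<gamma> \<omega> else 0)"
      unfolding coef_M split_def
      by (intro sum.cong refl) (auto simp: coef_monomial add_zero_right)
    then show ?thesis
      using finite_factorisations[of \<gamma>] by (simp add: add_zero_right)
  qed
  have norm_M1: "cinner (M_adj \<omega> (M \<omega> (e zero))) (e zero) = of_real ((norm (M \<omega> (e zero)))\<^sup>2)" for \<omega>
    by (simp only: M.cinner_cadjoint' cinner_self)
  have int1: "integrable P (\<lambda>\<omega>. \<Sum>\<gamma>\<in>A. (cmod (v \<gamma> \<omega>))\<^sup>2 * (norm (e \<gamma>))\<^sup>2)"
    by (intro Bochner_Integration.integrable_sum integrable_mult_left square_integrable)
  have int2: "integrable (completion P) (\<lambda>\<omega>. (norm (M \<omega> (e zero)))\<^sup>2)"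
    using C(2)[unfolded norm_M1] by (simp only: complex_of_real_integrable_eq)
  have "(\<Sum>\<gamma>\<in>A. w \<gamma> * (norm (e \<gamma>))\<^sup>2) = (LINT \<omega>|P. (\<Sum>\<gamma>\<in>A. (cmod (v \<gamma> \<omega>))\<^sup>2 * (norm (e \<gamma>))\<^sup>2))"
    by (simp add: w_def square_integrable)
  \<comment> \<open>The finite sum is measurable for \<open>P\<close> itself, so its integral can be
    moved to the completion, where \<open>(norm (M \<omega> (e zero)))\<^sup>2\<close> is known to
    be integrable.\<close>
  also have "\<dots> = (LINT \<omega>|completion P. (\<Sum>\<gamma>\<in>A. (cmod (v \<gamma> \<omega>))\<^sup>2 * (norm (e \<gamma>))\<^sup>2))"
    by (rule integral_completion[symmetric]) (use int1 in simp)
  also have "\<dots> \<le> (LINT \<omega>|completion P. (norm (M \<omega> (e zero)))\<^sup>2)"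
  proof (rule integral_mono)
    show "integrable (completion P) (\<lambda>\<omega>. \<Sum>\<gamma>\<in>A. (cmod (v \<gamma> \<omega>))\<^sup>2 * (norm (e \<gamma>))\<^sup>2)"
      using int1 by (simp add: integrable_completion)
    show "(\<Sum>\<gamma>\<in>A. (cmod (v \<gamma> \<omega>))\<^sup>2 * (norm (e \<gamma>))\<^sup>2) \<le> (norm (M \<omega> (e zero)))\<^sup>2" for \<omega>
      using bessel[OF \<open>finite A\<close>, of "M \<omega> (e zero)"] by (simp add: coef_M1)
  qed (rule int2)
  also have "\<dots> = Re (cinner (C (e zero)) (e zero))"
    unfolding C(3) norm_M1 integral_complex_of_real by simp
  also have "\<dots> \<le> norm (C (e zero)) * norm (e zero)"
    using complex_Re_le_cmod cmod_cinner_le by (rule order_trans)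
  \<comment> \<open>The normalisation enters here: the operator norm bounds the product by
    \<open>onorm C * (norm (e zero))\<^sup>2\<close>.\<close>
  also have "\<dots> \<le> onorm C"
    using onorm[OF C(1), of "e zero"] by (simp add: unit)
  finally show ?thesis .
qed

lemma onorm_row_le_onorm_column:
  assumes R: "is_row_expectation add coef P v R" and C: "is_column_expectation add coef P v C"
    and unit: "norm (e zero) = 1"
  shows "onorm R \<le> onorm C"
proof (rule onorm_diagonal_le)
  show "bounded_operator R"
    by (rule bounded_operator_weak_expectation[OF R[unfolded is_row_expectation_iff] bounded_operator_row])
  show "R (e \<delta>) = scaleC (\<Sum>(\<alpha>, \<beta>)\<in>facs \<delta>. of_real (w \<alpha> * (norm (e \<delta>))\<^sup>2 / (norm (e \<beta>))\<^sup>2)) (e \<delta>)" for \<delta>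
    by (rule row_expectation_monomial[OF R])
  show "cmod (\<Sum>(\<alpha>, \<beta>)\<in>facs \<delta>. of_real (w \<alpha> * (norm (e \<delta>))\<^sup>2 / (norm (e \<beta>))\<^sup>2)) \<le> onorm C" for \<delta>
  proof -
    have "cmod (\<Sum>(\<alpha>, \<beta>)\<in>facs \<delta>. of_real (w \<alpha> * (norm (e \<delta>))\<^sup>2 / (norm (e \<beta>))\<^sup>2))
        \<le> (\<Sum>p\<in>facs \<delta>. w (fst p) * (norm (e (fst p)))\<^sup>2)"
    proof (rule sum_norm_le, clarsimp simp only: split_paired_all mem_Collect_eq prod.case fst_conv norm_of_real)
      fix \<alpha> \<beta>
      \<comment> \<open>The squared committee inequality, divided by
        \<open>(norm (e \<beta>))\<^sup>2\<close>, bounds the norm ratio by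
        \<open>(norm (e \<alpha>))\<^sup>2\<close>.\<close>
      have "(norm (e (add \<alpha> \<beta>)))\<^sup>2 \<le> (norm (e \<alpha>) * norm (e \<beta>))\<^sup>2"
        by (intro power_mono committee_inequality) simp
      then have "w \<alpha> * (norm (e (add \<alpha> \<beta>)))\<^sup>2 \<le> w \<alpha> * ((norm (e \<alpha>))\<^sup>2 * (norm (e \<beta>))\<^sup>2)"
        unfolding power_mult_distrib by (rule mult_left_mono[OF _ w_nonneg])
      then show "\<bar>w \<alpha> * (norm (e (add \<alpha> \<beta>)))\<^sup>2 / (norm (e \<beta>))\<^sup>2\<bar> \<le> w \<alpha> * (norm (e \<alpha>))\<^sup>2"
        using norm_monomial_pos[of \<beta>] by (simp add: pos_divide_le_eq w_nonneg mult.assoc)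
    qed
    \<comment> \<open>Left cancellation makes \<open>fst\<close> injective on
      \<open>facs \<delta>\<close>, so no \<alpha> is counted twice.\<close>
    also have "\<dots> = (\<Sum>\<alpha>\<in>fst ` facs \<delta>. w \<alpha> * (norm (e \<alpha>))\<^sup>2)"
      by (subst sum.reindex) (auto simp: inj_on_def dest: add_left_cancel)
    also have "\<dots> \<le> onorm C"
      using finite_factorisations by (intro sum_w_le_onorm_column[OF C unit] finite_imageI)
    finally show ?thesis .
  qed
qed

end

text \<open>Redefining the coefficients as \<open>0\<close> on a null set makes the multiplier bound hold everywhere and
  removes measurability problems at points where \<open>mult_op\<close> is a junk value.\<close>

lemma uniform_multiplier_model_modification:
  fixes coef :: "'h::complex_hilbert_space \<Rightarrow> 'm \<Rightarrow> complex"
  assumes "random_multiplier_model add coef P v" "cancellative_multi_index add zero"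
  obtains v' K where "uniform_multiplier_model add zero coef P v' K"
    and "is_row_expectation add coef P v = is_row_expectation add coef P v'"
    and "is_column_expectation add coef P v = is_column_expectation add coef P v'"
proof -
  interpret random_multiplier_model add coef P v by fact
  interpret cancellative_multi_index add zero by fact
  obtain K where K: "K > 0" "AE \<omega> in P. multiplier add coef (\<lambda>\<gamma>. v \<gamma> \<omega>) \<and>
      onorm (mult_op add coef (\<lambda>\<gamma>. v \<gamma> \<omega>)) \<le> K"
    using bounded_multiplier by blast
  obtain N where N: "N \<in> null_sets P" "\<And>\<omega>. \<omega> \<in> space P - N \<Longrightarrow>
      multiplier add coef (\<lambda>\<gamma>. v \<gamma> \<omega>) \<and> onorm (mult_op add coef (\<lambda>\<gamma>. v \<gamma> \<omega>)) \<le> K"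
    by (rule AE_E3[OF K(2)]) blast
  define G where "G = space P - N"
  have G: "G \<in> sets P"
    using N by (auto simp: G_def)
  define v' where "v' \<gamma> \<omega> = (if \<omega> \<in> G then v \<gamma> \<omega> else 0)" for \<gamma> \<omega>
  have ae: "AE \<omega> in P. \<omega> \<in> G"
    using AE_not_in[OF N(1)] AE_space by eventually_elim (simp add: G_def)
  have meas: "v' \<gamma> \<in> borel_measurable P" for \<gamma>
    unfolding v'_def using random_variable_v[of \<gamma>] G by (intro measurable_If_set) auto
  \<comment> \<open>Off \<open>G\<close> the modified series is zero; its multiplication operator is
    the zero operator and satisfies the bound because \<open>K > 0\<close>.\<close>
  have mult_zero: "mult_op add coef (\<lambda>\<gamma>. 0) = (\<lambda>h. 0)"
  proof
    fix h
    have "coef 0 = series_mult add (\<lambda>\<gamma>. 0) (coef h)"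
      by (auto simp: series_mult_def)
    then show "mult_op add coef (\<lambda>\<gamma>. 0) h = 0"
      unfolding mult_op_def using inv_f_f[OF inj_coeff, of 0] by simp
  qed
  have mult: "multiplier add coef (\<lambda>\<gamma>. v' \<gamma> \<omega>) \<and> onorm (mult_op add coef (\<lambda>\<gamma>. v' \<gamma> \<omega>)) \<le> K" for \<omega>
  proof (cases "\<omega> \<in> G")
    case True
    then show ?thesis
      using N(2)[of \<omega>] by (simp add: v'_def G_def)
  next
    case False
    have "series_mult add (\<lambda>\<gamma>. 0) (coef h) = coef 0" for h
      by (auto simp: series_mult_def)
    then have "multiplier add coef (\<lambda>\<gamma>. 0)"
      unfolding multiplier_def mult_zero by (metis bounded_linear_zero rangeI)
    then show ?thesis
      using False K(1) by (simp add: v'_def mult_zero onorm_zero)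
  qed
  have "uniform_multiplier_model add zero coef P v' K"
  proof unfold_locales
    show "integrable P (\<lambda>\<omega>. (cmod (v' \<gamma> \<omega>))\<^sup>2)" for \<gamma>
    proof (rule integrable_cong_AE_imp[OF square_integrable])
      show "(\<lambda>\<omega>. (cmod (v' \<gamma> \<omega>))\<^sup>2) \<in> borel_measurable P"
        using measurable_compose[OF meas borel_measurable_norm] by (intro borel_measurable_power) simp
      show "AE \<omega> in P. (cmod (v \<gamma> \<omega>))\<^sup>2 = (cmod (v' \<gamma> \<omega>))\<^sup>2"
        using ae by eventually_elim (simp add: v'_def)
    qed
    show "(LINT \<omega>|P. cnj (v' \<gamma> \<omega>) * v' \<gamma>' \<omega>) = 0" if "\<gamma> \<noteq> \<gamma>'" for \<gamma> \<gamma>'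
    proof -
      have m: "(\<lambda>\<omega>. cnj (f \<omega>) * g \<omega>) \<in> borel_measurable P"
        if "f \<in> borel_measurable P" "g \<in> borel_measurable P" for f g
        by (intro borel_measurable_times that
            borel_measurable_continuous_on[OF continuous_on_cnj[OF continuous_on_id]])
      have "AE \<omega> in P. cnj (v' \<gamma> \<omega>) * v' \<gamma>' \<omega> = cnj (v \<gamma> \<omega>) * v \<gamma>' \<omega>"
        using ae by eventually_elim (simp add: v'_def)
      then have "(LINT \<omega>|P. cnj (v' \<gamma> \<omega>) * v' \<gamma>' \<omega>) = (LINT \<omega>|P. cnj (v \<gamma> \<omega>) * v \<gamma>' \<omega>)"
        by (intro integral_cong_AE m meas random_variable_v)
      then show ?thesis
        using uncorrelated[OF that] by simp
    qed
  qed (use meas mult in auto)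
  \<comment> \<open>The operators are unchanged on \<open>G\<close>, so exactly the same operators
    represent the expectations for \<open>v\<close> and for \<open>v'\<close>.\<close>
  moreover have "is_row_expectation add coef P v = is_row_expectation add coef P v'"
    unfolding is_row_expectation_def
    by (intro ext has_weak_expectation_cong_AE) (use ae in eventually_elim, simp add: v'_def)
  moreover have "is_column_expectation add coef P v = is_column_expectation add coef P v'"
    unfolding is_column_expectation_def
    by (intro ext has_weak_expectation_cong_AE) (use ae in eventually_elim, simp add: v'_def)
  ultimately show ?thesis
    by (rule that)
qed

lemma row_column_expectations:
  fixes coef :: "'h::complex_hilbert_space \<Rightarrow> 'm \<Rightarrow> complex"
  assumes model: "random_multiplier_model add coef P v" "cancellative_multi_index add zero"
    and unit: "norm (monomial_vec coef zero) = 1"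
  shows "countable (UNIV :: 'm set) \<Longrightarrow>
      (\<exists>R. is_row_expectation add coef P v R) \<and> (\<exists>C. is_column_expectation add coef P v C)"
    and "is_row_expectation add coef P v R \<Longrightarrow> is_column_expectation add coef P v C \<Longrightarrow>
      onorm R \<le> onorm C"
proof -
  obtain v' K where "uniform_multiplier_model add zero coef P v' K"
    and eq: "is_row_expectation add coef P v = is_row_expectation add coef P v'"
      "is_column_expectation add coef P v = is_column_expectation add coef P v'"
    using uniform_multiplier_model_modification[OF model] .
  then interpret uniform_multiplier_model add zero coef P v' K by simp
  show "countable (UNIV :: 'm set) \<Longrightarrow>
      (\<exists>R. is_row_expectation add coef P v R) \<and> (\<exists>C. is_column_expectation add coef P v C)"
    unfolding eq using exists_row_expectation exists_column_expectation by blast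
  show "is_row_expectation add coef P v R \<Longrightarrow> is_column_expectation add coef P v C \<Longrightarrow>
      onorm R \<le> onorm C"
    unfolding eq using onorm_row_le_onorm_column unit by blast
qed

section \<open>Commuting and noncommuting multi-indices\<close>

text \<open>An exponent below \<gamma> vanishes off the finite set \<open>keys \<gamma>\<close>,
  hence is determined by its restriction to it, where each value has finitely many possibilities.
  This covers infinitely many variables too.\<close>

lemma finite_poly_mapping_le: "finite {\<alpha>. \<forall>i. Poly_Mapping.lookup \<alpha> i \<le> Poly_Mapping.lookup (\<gamma> :: 'i \<Rightarrow>\<^sub>0 nat) i}"
proof -
  let ?B = "PiE (Poly_Mapping.keys \<gamma>) (\<lambda>i. {..Poly_Mapping.lookup \<gamma> i})"
  let ?f = "\<lambda>\<alpha> :: 'i \<Rightarrow>\<^sub>0 nat. restrict (Poly_Mapping.lookup \<alpha>) (Poly_Mapping.keys \<gamma>)"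
  let ?S = "{\<alpha>. \<forall>i. Poly_Mapping.lookup \<alpha> i \<le> Poly_Mapping.lookup \<gamma> i}"
  have "inj_on ?f ?S"
  proof (rule inj_onI, rule poly_mapping_eqI)
    fix \<alpha> \<beta> i assume *: "\<alpha> \<in> ?S" "\<beta> \<in> ?S" "?f \<alpha> = ?f \<beta>"
    show "Poly_Mapping.lookup \<alpha> i = Poly_Mapping.lookup \<beta> i"
    proof (cases "i \<in> Poly_Mapping.keys \<gamma>")
      case True
      with fun_cong[OF *(3), of i] show ?thesis by simp
    next
      case False
      then have "Poly_Mapping.lookup \<gamma> i = 0"
        by (simp add: in_keys_iff)
      moreover have "Poly_Mapping.lookup \<alpha> i \<le> Poly_Mapping.lookup \<gamma> i"
        "Poly_Mapping.lookup \<beta> i \<le> Poly_Mapping.lookup \<gamma> i"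
        using *(1,2) by blast+
      ultimately show ?thesis
        by simp
    qed
  qed
  moreover have "?f ` ?S \<subseteq> ?B"
    by auto
  moreover have "finite ?B"
    by (intro finite_PiE) auto
  ultimately show "finite ?S"
    by (meson finite_imageD finite_subset)
qed

lemma cancellative_multi_index_poly_mapping:
  "cancellative_multi_index ((+) :: ('i \<Rightarrow>\<^sub>0 nat) \<Rightarrow> _) 0"
proof
  fix \<gamma> :: "'i \<Rightarrow>\<^sub>0 nat"
  let ?S = "{\<alpha>. \<forall>i. Poly_Mapping.lookup \<alpha> i \<le> Poly_Mapping.lookup \<gamma> i}"
  \<comment> \<open>Both summands are pointwise below their sum.\<close>
  have "{(\<alpha>, \<beta>). \<alpha> + \<beta> = \<gamma>} \<subseteq> ?S \<times> ?S"
    by (auto simp: lookup_add)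
  then show "finite {(\<alpha>, \<beta>). \<alpha> + \<beta> = \<gamma>}"
    by (rule finite_subset) (intro finite_cartesian_product finite_poly_mapping_le)
qed auto

lemma cancellative_multi_index_list: "cancellative_multi_index ((@) :: 'i list \<Rightarrow> _) []"
proof
  fix \<gamma> :: "'i list"
  \<comment> \<open>A factorisation of a word amounts to a cut position.\<close>
  have "{(\<alpha>, \<beta>). \<alpha> @ \<beta> = \<gamma>} \<subseteq> (\<lambda>n. (take n \<gamma>, drop n \<gamma>)) ` {..length \<gamma>}"
  proof clarify
    fix \<alpha> \<beta> assume "\<gamma> = \<alpha> @ \<beta>"
    then show "(\<alpha>, \<beta>) \<in> (\<lambda>n. (take n (\<alpha> @ \<beta>), drop n (\<alpha> @ \<beta>))) ` {..length (\<alpha> @ \<beta>)}"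
      by (intro image_eqI[where x = "length \<alpha>"]) auto
  qed
  then show "finite {(\<alpha>, \<beta>). \<alpha> @ \<beta> = \<gamma>}"
    by (rule finite_subset) simp
qed auto

text \<open>An exponent is encoded by its graph over its support, a finite subset of a countable
  set.\<close>

lemma countable_poly_mapping:
  assumes "countable (UNIV :: 'i set)"
  shows "countable (UNIV :: ('i \<Rightarrow>\<^sub>0 nat) set)"
proof -
  let ?f = "\<lambda>\<alpha> :: 'i \<Rightarrow>\<^sub>0 nat. (\<lambda>i. (i, Poly_Mapping.lookup \<alpha> i)) ` Poly_Mapping.keys \<alpha>"
  have "inj ?f"
  proof (rule injI, rule poly_mapping_eqI)
    fix \<alpha> \<beta> i assume eq: "?f \<alpha> = ?f \<beta>"
    \<comment> \<open>The graph omits zero values, so the value 0 is recognised by the absence of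
      any pair with first component \<open>i\<close>.\<close>
    have graph: "Poly_Mapping.lookup \<alpha> i = n \<longleftrightarrow> (if n = 0 then \<forall>m. (i, m) \<notin> ?f \<alpha> else (i, n) \<in> ?f \<alpha>)"
      for \<alpha> n
      by (auto simp: in_keys_iff image_iff)
    show "Poly_Mapping.lookup \<alpha> i = Poly_Mapping.lookup \<beta> i"
      unfolding graph[of \<alpha>] eq graph[of \<beta>, symmetric] ..
  qed
  moreover have "countable (UNIV :: ('i \<times> nat) set)"
    unfolding UNIV_Times_UNIV[symmetric] by (intro countable_SIGMA assms countableI_type)
  then have "countable {A. finite A \<and> A \<subseteq> (UNIV :: ('i \<times> nat) set)}"
    by (rule countable_Collect_finite_subset)
  then have "countable (range ?f)"
    by (rule countable_subset[rotated]) auto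
  ultimately show "countable (UNIV :: ('i \<Rightarrow>\<^sub>0 nat) set)"
    by (rule countable_image_inj_on[rotated])
qed

lemma countable_list:
  assumes "countable (UNIV :: 'i set)"
  shows "countable (UNIV :: 'i list set)"
  using countable_lists[OF assms] by simp

text \<open>The expectations enter as relations, so the inequality holds for any operators
  representing them; the existence clauses keep it from being vacuous for countably many variables.
  The two halves treat commuting and noncommuting variables.\<close>

theorem theorem3p1:
  fixes coef :: "'h::complex_hilbert_space \<Rightarrow> ('i \<Rightarrow>\<^sub>0 nat) \<Rightarrow> complex"
    and v :: "('i \<Rightarrow>\<^sub>0 nat) \<Rightarrow> 'w \<Rightarrow> complex"
    and coef' :: "'k::complex_hilbert_space \<Rightarrow> 'i list \<Rightarrow> complex"
    and v' :: "'i list \<Rightarrow> 'w \<Rightarrow> complex"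
    and P :: "'w measure"
  shows
    "(random_multiplier_model (+) coef P v \<and> norm (monomial_vec coef 0) = 1 \<longrightarrow>
        (countable (UNIV :: 'i set) \<longrightarrow>
           (\<exists>R. is_row_expectation (+) coef P v R) \<and>
           (\<exists>C. is_column_expectation (+) coef P v C)) \<and>
        (\<forall>R C. is_row_expectation (+) coef P v R \<and> is_column_expectation (+) coef P v C
           \<longrightarrow> onorm R \<le> onorm C))
     \<and>
     (random_multiplier_model (@) coef' P v' \<and> norm (monomial_vec coef' []) = 1 \<longrightarrow>
        (countable (UNIV :: 'i set) \<longrightarrow>
           (\<exists>R. is_row_expectation (@) coef' P v' R) \<and>
           (\<exists>C. is_column_expectation (@) coef' P v' C)) \<and>
        (\<forall>R C. is_row_expectation (@) coef' P v' R \<and> is_column_expectation (@) coef' P v' C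
           \<longrightarrow> onorm R \<le> onorm C))"
proof (rule conjI; rule impI; elim conjE; intro conjI impI allI; (elim conjE)?)
  assume c: "random_multiplier_model (+) coef P v" "norm (monomial_vec coef 0) = 1"
  note comm = row_column_expectations[OF c(1) cancellative_multi_index_poly_mapping c(2)]
  show "\<exists>R. is_row_expectation (+) coef P v R" "\<exists>C. is_column_expectation (+) coef P v C"
    if "countable (UNIV :: 'i set)"
    using comm(1)[OF countable_poly_mapping[OF that]] by blast+
  show "onorm R \<le> onorm C" if "is_row_expectation (+) coef P v R" "is_column_expectation (+) coef P v C" for R C
    using that by (rule comm(2))
next
  assume n: "random_multiplier_model (@) coef' P v'" "norm (monomial_vec coef' []) = 1"
  note noncomm = row_column_expectations[OF n(1) cancellative_multi_index_list n(2)]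
  show "\<exists>R. is_row_expectation (@) coef' P v' R" "\<exists>C. is_column_expectation (@) coef' P v' C"
    if "countable (UNIV :: 'i set)"
    using noncomm(1)[OF countable_list[OF that]] by blast+
  show "onorm R \<le> onorm C"
    if "is_row_expectation (@) coef' P v' R" "is_column_expectation (@) coef' P v' C" for R C
    using that by (rule noncomm(2))
qed

end
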